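(* Let $D$ be a directed graph of order $n$ with strong diameter $2$. Then $\pi(D)<\frac{3}{2}n$. Further, this bound is sharp: for every positive integer $k$ there is a directed graph with strong diameter $2$ on $n=2k+1$ vertices whose pebbling number is $3k+1$, the largest integer less than $\frac32 n$.
   Context: Directed graphs are loopless and may contain both arcs $i\to j$ and $j\to i$. $D$ has strong diameter $2$ if for every ordered pair of distinct vertices $(i,j)$ there is a directed path from $i$ to $j$ of length at most $2$. A configuration is a function $C:V(D)\to\mathbb{N}$; its size is $\sum_v C(v)$. A pebbling move along an arc $i\to j$ removes two pebbles from $i$ and adds one pebble to $j$. Given a root $r$, a configuration is $r$-solvable if some sequence (possibly empty) of pebbling moves places a pebble on $r$. The pebbling number $\pi(D)$ is the minimum $t$ such that every configuration of size $t$ is $r$-solvable for every root $r$. *)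

theory Defs
  imports Complex_Main "Graph_Theory.Graph_Theory"
begin

(* As in the source, the requirement is "at most 2": complete digraphs and the
   one-vertex digraph satisfy it. *)
definition strong_diameter_2 :: "('a, 'b) pre_digraph \<Rightarrow> bool" where
  "strong_diameter_2 D \<longleftrightarrow>
     (\<forall>i\<in>verts D. \<forall>j\<in>verts D. i \<noteq> j \<longrightarrow>
        (\<exists>p. pre_digraph.apath D i p j \<and> length p \<le> 2))"

(* A configuration is represented by a total function on the vertex type. Its values
   outside "verts D" are irrelevant: they do not count towards the size, and in a
   well-formed digraph no move reads or changes them. *)
type_synonym 'a configuration = "'a \<Rightarrow> nat"

definition config_size :: "('a, 'b) pre_digraph \<Rightarrow> 'a configuration \<Rightarrow> nat" where
  "config_size D C = (\<Sum>v\<in>verts D. C v)"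

(* The two updates are independent only because digraphs are loopless. *)
definition pebbling_move ::
  "('a, 'b) pre_digraph \<Rightarrow> 'a configuration \<Rightarrow> 'a configuration \<Rightarrow> bool" where
  "pebbling_move D C C' \<longleftrightarrow>
     (\<exists>e\<in>arcs D. C (tail D e) \<ge> 2 \<and>
        C' = C(tail D e := C (tail D e) - 2, head D e := C (head D e) + 1))"

definition solvable :: "('a, 'b) pre_digraph \<Rightarrow> 'a \<Rightarrow> 'a configuration \<Rightarrow> bool" where
  "solvable D r C \<longleftrightarrow> (\<exists>C'. (pebbling_move D)\<^sup>*\<^sup>* C C' \<and> C' r \<ge> 1)"

definition pebbling_number :: "('a, 'b) pre_digraph \<Rightarrow> nat" where
  "pebbling_number D =
     (LEAST t. \<forall>C. config_size D C = t \<longrightarrow> (\<forall>r\<in>verts D. solvable D r C))"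

end

theory Submission
  imports Defs
begin

text \<open>
  Suppose that \<open>r\<close> cannot be reached from \<open>C\<close>. A vertex \<open>b\<close> with at least two pebbles has no arc
  to \<open>r\<close>, so there is a vertex \<open>f b\<close> with \<open>b \<rightarrow> f b \<rightarrow> r\<close>. Then \<open>b\<close> has at most three
  pebbles, \<open>f b\<close> has none, and \<open>f\<close> is injective, since otherwise two pebbles could be collected on
  some \<open>f b\<close>. As all remaining vertices carry at most one pebble and \<open>r\<close> none, the \<open>n - 1\<close> vertices
  other than \<open>r\<close> carry at most \<open>3/2\<close> pebbles on average.

  For sharpness, take a root \<open>r\<close> and pairs \<open>a\<^sub>i, b\<^sub>i\<close> for \<open>1 \<le> i \<le> k\<close>, where the only arc out of
  \<open>b\<^sub>i\<close> goes to \<open>a\<^sub>i\<close> while \<open>r\<close> and all \<open>a\<^sub>i\<close> have arcs to all other vertices. With at most three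
  pebbles on each \<open>b\<^sub>i\<close> and none elsewhere, each \<open>a\<^sub>i\<close> can receive at most one pebble.
\<close>

section \<open>Solving by single moves, and distance at most two in terms of arcs\<close>

lemma solvable_if_pebbled: "C r \<ge> 1 \<Longrightarrow> solvable D r C"
  unfolding solvable_def by blast

lemma solvable_if_arc:
  assumes "(u, v) \<in> arcs_ends D" "C u \<ge> 2"
    and "solvable D r (C(u := C u - 2, v := C v + 1))"
  shows "solvable D r C"
proof -
  have "pebbling_move D C (C(u := C u - 2, v := C v + 1))"
    using assms(1,2) unfolding pebbling_move_def arcs_ends_def arc_to_ends_def by auto
  with assms(3) show ?thesis
    unfolding solvable_def by (meson converse_rtranclp_into_rtranclp)
qed

lemma solvable_if_arc_to_root:
  assumes "(u, r) \<in> arcs_ends D" "C u \<ge> 2"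
  shows "solvable D r C"
  by (rule solvable_if_arc[where C = C, OF assms], rule solvable_if_pebbled) simp

text \<open>Without loops, the middle vertex of two consecutive arcs differs from both ends, so for
  distinct ends the two arcs form a path and not just a walk.\<close>

lemma (in wf_digraph) strong_diameter_2_iff:
  assumes "\<And>v. (v, v) \<notin> arcs_ends G"
  shows "strong_diameter_2 G \<longleftrightarrow>
    (\<forall>i\<in>verts G. \<forall>j\<in>verts G. i \<noteq> j \<longrightarrow>
      (i, j) \<in> arcs_ends G \<or> (\<exists>m. (i, m) \<in> arcs_ends G \<and> (m, j) \<in> arcs_ends G))"
proof -
  have "(\<exists>p. apath i p j \<and> length p \<le> 2) \<longleftrightarrow>
      (i, j) \<in> arcs_ends G \<or> (\<exists>m. (i, m) \<in> arcs_ends G \<and> (m, j) \<in> arcs_ends G)"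
    (is "?path \<longleftrightarrow> ?arcs")
    if "i \<in> verts G" "j \<in> verts G" "i \<noteq> j" for i j
  proof
    assume ?path
    then obtain p where p: "awalk i p j" "length p \<le> 2"
      by (auto simp: apath_def)
    then consider "p = []" | e where "p = [e]" | e e' where "p = [e, e']"
      by (cases p rule: remdups_adj.cases) (auto simp: le_Suc_eq)
    then show ?arcs
    proof cases
      case 1
      with p \<open>i \<noteq> j\<close> show ?thesis by (auto simp: awalk_def)
    next
      case 2
      with p have "e \<in> arcs G" "tail G e = i" "head G e = j"
        by (auto simp: awalk_simps)
      then show ?thesis by (auto simp: arcs_ends_def arc_to_ends_def)
    next
      case 3
      with p have "e \<in> arcs G" "tail G e = i" "e' \<in> arcs G" "tail G e' = head G e" "head G e' = j"
        by (auto simp: awalk_simps)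
      then have "(i, head G e) \<in> arcs_ends G" "(head G e, j) \<in> arcs_ends G"
        by (force simp: arcs_ends_def arc_to_ends_def)+
      then show ?thesis by blast
    qed
  next
    assume ?arcs
    then show ?path
    proof
      assume "(i, j) \<in> arcs_ends G"
      then obtain e where "e \<in> arcs G" "tail G e = i" "head G e = j"
        by (auto simp: arcs_ends_def arc_to_ends_def)
      then have "apath i [e] j"
        using that by (auto simp: apath_def awalk_simps)
      then show ?path by (intro exI[of _ "[e]"]) simp
    next
      assume "\<exists>m. (i, m) \<in> arcs_ends G \<and> (m, j) \<in> arcs_ends G"
      then obtain m e e' where "e \<in> arcs G" "tail G e = i" "head G e = m"
        "e' \<in> arcs G" "tail G e' = m" "head G e' = j" "m \<noteq> i" "m \<noteq> j"
        using assms by (fastforce simp: arcs_ends_def arc_to_ends_def)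
      then have "apath i [e, e'] j"
        using that by (auto simp: apath_def awalk_simps)
      then show ?path by (intro exI[of _ "[e, e']"]) simp
    qed
  qed
  then show ?thesis
    unfolding strong_diameter_2_def by (simp cong: ball_cong)
qed

section \<open>Upper bound\<close>

lemma (in digraph) config_size_unsolvable_le:
  assumes "strong_diameter_2 G" "r \<in> verts G" "\<not> solvable G r C"
  shows "2 * config_size G C + 3 \<le> 3 * card (verts G)"
proof -
  let ?V = "verts G"
  define B where "B = {v \<in> ?V. C v \<ge> 2}"
  have loopfree: "(v, v) \<notin> arcs_ends G" for v
    using no_loops by (auto simp: arcs_ends_def arc_to_ends_def)
  have "C r = 0"
    using assms(3) solvable_if_pebbled[of C r G] by fastforce
  have no_arc: "(b, r) \<notin> arcs_ends G" if "b \<in> B" for b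
    using that assms(3) solvable_if_arc_to_root[of b r G C] by (auto simp: B_def)
  have "\<exists>m. (b, m) \<in> arcs_ends G \<and> (m, r) \<in> arcs_ends G" if "b \<in> B" for b
  proof -
    have "b \<in> ?V" "b \<noteq> r"
      using that \<open>C r = 0\<close> by (auto simp: B_def)
    then show ?thesis
      using assms(1,2) no_arc[OF that] unfolding strong_diameter_2_iff[OF loopfree] by blast
  qed
  then have "\<exists>f. \<forall>b\<in>B. (b, f b) \<in> arcs_ends G \<and> (f b, r) \<in> arcs_ends G"
    by (intro bchoice ballI)
  then obtain f where f: "\<And>b. b \<in> B \<Longrightarrow> (b, f b) \<in> arcs_ends G"
    and f_r: "\<And>b. b \<in> B \<Longrightarrow> (f b, r) \<in> arcs_ends G"
    by blast
  have f_ne: "f b \<noteq> b" if "b \<in> B" for b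
    using f[OF that] loopfree by metis
  have f_empty: "C (f b) = 0" if "b \<in> B" for b
  proof (rule ccontr)
    assume "C (f b) \<noteq> 0"
    then have "solvable G r (C(b := C b - 2, f b := C (f b) + 1))"
      by (intro solvable_if_arc_to_root[OF f_r[OF that]]) simp
    then show False
      using solvable_if_arc[where C = C, OF f[OF that]] that assms(3) by (auto simp: B_def)
  qed
  have le_3: "C b \<le> 3" if "b \<in> B" for b
  proof (rule ccontr)
    assume ge: "\<not> C b \<le> 3"
    let ?C = "C(b := C b - 2, f b := C (f b) + 1)"
    have "solvable G r (?C(b := ?C b - 2, f b := ?C (f b) + 1))"
      by (intro solvable_if_arc_to_root[OF f_r[OF that]]) simp
    then have "solvable G r ?C"
      using ge f_ne[OF that] by (intro solvable_if_arc[where C = ?C, OF f[OF that]]) auto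
    then show False
      using solvable_if_arc[where C = C, OF f[OF that]] that assms(3) by (auto simp: B_def)
  qed
  have "inj_on f B"
  proof (rule inj_onI, rule ccontr)
    fix b c assume bc: "b \<in> B" "c \<in> B" "f b = f c" "b \<noteq> c"
    define m where "m = f c"
    have arcs: "(b, m) \<in> arcs_ends G" "(c, m) \<in> arcs_ends G" "(m, r) \<in> arcs_ends G"
      using f[OF bc(1)] f[OF bc(2)] f_r[OF bc(2)] bc(3) by (simp_all add: m_def)
    have ne: "m \<noteq> b" "m \<noteq> c"
      using f_ne[OF bc(1)] f_ne[OF bc(2)] bc(3) by (simp_all add: m_def)
    have ge_2: "C b \<ge> 2" "C c \<ge> 2"
      using bc(1,2) by (simp_all add: B_def)
    let ?C = "C(b := C b - 2, m := C m + 1)"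
    have "solvable G r (?C(c := ?C c - 2, m := ?C m + 1))"
      by (rule solvable_if_arc_to_root[OF arcs(3)]) (simp add: ne)
    then have "solvable G r ?C"
      using ne ge_2 \<open>b \<noteq> c\<close> by (intro solvable_if_arc[where C = ?C, OF arcs(2)]) auto
    then show False
      using solvable_if_arc[where C = C, OF arcs(1)] ge_2 assms(3) by blast
  qed
  have "B \<subseteq> ?V" "f ` B \<subseteq> ?V"
    using adj_in_verts(2)[OF f] by (auto simp: B_def)
  then have fin: "finite B" "finite (f ` B)"
    using finite_verts by (blast intro: finite_subset)+
  have disj: "B \<inter> f ` B = {}" "r \<notin> B" "r \<notin> f ` B"
    using f_empty \<open>C r = 0\<close> f_r loopfree by (auto simp: B_def)
  have card_fB: "card (f ` B) = card B"
    by (rule card_image) fact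
  have "card (insert r (B \<union> f ` B)) \<le> card ?V"
    using \<open>B \<subseteq> ?V\<close> \<open>f ` B \<subseteq> ?V\<close> assms(2) by (intro card_mono) auto
  then have B_le: "2 * card B + 1 \<le> card ?V"
    using fin disj by (simp add: card_Un_disjoint card_fB)
  have card_eq: "(\<Sum>v\<in>?V. of_bool (v \<in> S)) = card S" if "S \<subseteq> ?V" for S
    using that by (simp add: sum_of_bool_eq Int_absorb1 flip: Int_def)
  \<comment> \<open>The indicator on the left records the vertices known to be empty: the root and
    the image of \<open>B\<close>. Pointwise, this says at most three pebbles on \<open>B\<close>,
    none on those vertices, and at most one elsewhere.\<close>
  have "(\<Sum>v\<in>?V. C v + of_bool (v \<in> insert r (f ` B))) \<le> (\<Sum>v\<in>?V. 1 + 2 * of_bool (v \<in> B))"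
  proof (rule sum_mono)
    fix v assume "v \<in> ?V"
    then show "C v + of_bool (v \<in> insert r (f ` B)) \<le> 1 + 2 * of_bool (v \<in> B)"
      using le_3[of v] f_empty disj \<open>C r = 0\<close> by (cases "v \<in> B") (auto simp: B_def)
  qed
  then have "config_size G C + card (insert r (f ` B)) \<le> card ?V + 2 * card B"
    using \<open>B \<subseteq> ?V\<close> \<open>f ` B \<subseteq> ?V\<close> assms(2)
    by (simp only: sum.distrib card_eq config_size_def insert_subset simp_thms
        card_eq_sum[symmetric] flip: sum_distrib_left)
  then have "config_size G C + card B + 1 \<le> card ?V + 2 * card B"
    using fin disj card_fB by simp
  \<comment> \<open>Twice the size is at most \<open>2 * (n + card B - 1)\<close>, where
    \<open>n = card ?V\<close>, and \<open>B_le\<close> bounds \<open>2 * card B\<close> by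
    \<open>n - 1\<close>.\<close>
  with B_le show ?thesis by linarith
qed

text \<open>For \<open>n > 0\<close> this is the largest integer below \<open>3/2 * n\<close>. It
  already exceeds \<open>3/2 * (n - 1)\<close>, the most that an unsolvable configuration can
  hold.\<close>

lemma (in digraph) pebbling_number_le:
  assumes "strong_diameter_2 G"
  shows "pebbling_number G \<le> (3 * card (verts G) - 1) div 2"
  unfolding pebbling_number_def
proof (rule Least_le, intro allI impI ballI, rule ccontr)
  fix C r
  assume "config_size G C = (3 * card (verts G) - 1) div 2" "r \<in> verts G" "\<not> solvable G r C"
  with config_size_unsolvable_le[OF assms, of r C] show False by linarith
qed

section \<open>Sharpness\<close>

text \<open>The root is \<open>0\<close>, and \<open>a\<^sub>i\<close> and \<open>b\<^sub>i\<close> are \<open>2 * i - 1\<close> and \<open>2 * i\<close>.\<close>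

definition sharp_digraph :: "nat \<Rightarrow> (nat, nat \<times> nat) pre_digraph" where
  "sharp_digraph k = \<lparr>verts = {..2 * k},
     arcs = {(x, y). x \<le> 2 * k \<and> y \<le> 2 * k \<and> x \<noteq> y \<and> (even x \<and> x \<noteq> 0 \<longrightarrow> x = Suc y)},
     tail = fst, head = snd\<rparr>"

lemma arcs_ends_sharp_digraph: "arcs_ends (sharp_digraph k) = arcs (sharp_digraph k)"
  by (simp add: arcs_ends_def arc_to_ends_def sharp_digraph_def)

lemma digraph_sharp_digraph: "digraph (sharp_digraph k)"
proof
  show "finite (arcs (sharp_digraph k))"
    by (rule finite_subset[of _ "{..2 * k} \<times> {..2 * k}"]) (auto simp: sharp_digraph_def)
qed (auto simp: sharp_digraph_def arc_to_ends_def)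

lemma strong_diameter_2_sharp_digraph:
  assumes "k \<ge> 1"
  shows "strong_diameter_2 (sharp_digraph k)"
proof -
  interpret digraph "sharp_digraph k" by (rule digraph_sharp_digraph)
  have "(i, j) \<in> arcs (sharp_digraph k) \<or>
      (\<exists>m. (i, m) \<in> arcs (sharp_digraph k) \<and> (m, j) \<in> arcs (sharp_digraph k))"
    if "i \<le> 2 * k" "j \<le> 2 * k" "i \<noteq> j" for i j
  proof (cases "even i \<and> i \<noteq> 0 \<and> i \<noteq> Suc j")
    case True
    \<comment> \<open>Here \<open>i\<close> is some \<open>b\<close> and \<open>j\<close> is not its
      partner \<open>a\<close>, so the path goes through that partner; in every other case there is
      a direct arc.\<close>
    then have "(i, i - 1) \<in> arcs (sharp_digraph k)" "(i - 1, j) \<in> arcs (sharp_digraph k)"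
      using that by (auto simp: sharp_digraph_def)
    then show ?thesis by blast
  next
    case False
    with that show ?thesis by (auto simp: sharp_digraph_def)
  qed
  then show ?thesis
    by (subst strong_diameter_2_iff)
      (simp_all add: arcs_ends_sharp_digraph, simp_all add: sharp_digraph_def)
qed

text \<open>The weight counts a pebble on \<open>a\<close> twice, so the move from \<open>b\<close>
  to its partner \<open>a\<close> preserves it. Weight at most 3 leaves at most one pebble on each
  \<open>a\<close>; hence only moves of this kind ever occur, and none reaches the root.\<close>

lemma not_solvable_sharp_digraph:
  assumes "C 0 = 0" "\<And>i. C (2 * i + 2) + 2 * C (2 * i + 1) \<le> 3"
  shows "\<not> solvable (sharp_digraph k) 0 C"
proof
  let ?I = "\<lambda>C. C 0 = 0 \<and> (\<forall>i. C (2 * i + 2) + 2 * C (2 * i + 1) \<le> (3 :: nat))"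
  assume "solvable (sharp_digraph k) 0 C"
  then obtain C' where "(pebbling_move (sharp_digraph k))\<^sup>*\<^sup>* C C'" "C' 0 \<ge> 1"
    by (auto simp: solvable_def)
  moreover from this(1) have "?I C'"
  proof (induction rule: rtranclp_induct)
    case base
    with assms show ?case by blast
  next
    case (step E F)
    from step.hyps obtain x y where xy: "(x, y) \<in> arcs (sharp_digraph k)" "E x \<ge> 2"
      and F: "F = E(x := E x - 2, y := E y + 1)"
      by (auto simp: pebbling_move_def sharp_digraph_def)
    from step.IH xy(2) have "x \<noteq> 0" by (cases "x = 0") auto
    have "even x"
    proof (rule ccontr)
      assume "odd x"
      then obtain i where "x = 2 * i + 1" by (rule oddE)
      moreover have "E (2 * i + 2) + 2 * E (2 * i + 1) \<le> 3" using step.IH by blast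
      ultimately show False using xy(2) by simp
    qed
    with \<open>x \<noteq> 0\<close> xy(1) have y: "x = Suc y" "odd y"
      by (auto simp: sharp_digraph_def)
    then obtain j where j: "y = 2 * j + 1" by (auto elim: oddE)
    show ?case
    proof (intro conjI allI)
      show "F 0 = 0" using step.IH F y \<open>x \<noteq> 0\<close> by (auto simp: odd_pos)
      fix i
      have "E (2 * i + 2) + 2 * E (2 * i + 1) \<le> 3" using step.IH by blast
      then show "F (2 * i + 2) + 2 * F (2 * i + 1) \<le> 3"
        using F y(1) j xy(2) by (cases "i = j") auto
    qed
  qed
  ultimately show False by simp
qed

text \<open>The pebbling number is a least \<open>t\<close> for configurations of size exactly
  \<open>t\<close>, so every size up to \<open>3 * k\<close> needs its own unsolvable
  configuration.\<close>

lemma unsolvable_config_sharp_digraph: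
  assumes "t \<le> 3 * k"
  shows "\<exists>C. config_size (sharp_digraph k) C = t \<and> \<not> solvable (sharp_digraph k) 0 C"
proof (intro exI conjI)
  \<comment> \<open>Greedy filling: each \<open>b\<close> in turn receives three pebbles until
    \<open>t\<close> are used up. \<open>v div 2 - 1\<close> counts the earlier ones, and truncated
    subtraction leaves the rest empty.\<close>
  define C where "C = (\<lambda>v::nat. if odd v \<or> v = 0 then 0 else min 3 (t - 3 * (v div 2 - 1)))"
  have "sum C {..2 * l} = min t (3 * l)" for l
  proof (induction l)
    case 0
    show ?case by (simp add: C_def)
  next
    case (Suc l)
    have "C (Suc (2 * l)) = 0" "C (Suc (Suc (2 * l))) = min 3 (t - 3 * l)"
      by (simp_all add: C_def)
    with Suc.IH show ?case by simp
  qed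
  with assms show "config_size (sharp_digraph k) C = t"
    by (simp add: config_size_def sharp_digraph_def)
  show "\<not> solvable (sharp_digraph k) 0 C"
    by (rule not_solvable_sharp_digraph) (simp_all add: C_def)
qed

lemma pebbling_number_sharp_digraph:
  assumes "k \<ge> 1"
  shows "pebbling_number (sharp_digraph k) = 3 * k + 1"
proof -
  interpret digraph "sharp_digraph k" by (rule digraph_sharp_digraph)
  have "card (verts (sharp_digraph k)) = 2 * k + 1" "0 \<in> verts (sharp_digraph k)"
    by (simp_all add: sharp_digraph_def)
  note V = this
  show ?thesis
    unfolding pebbling_number_def
  proof (rule Least_equality, intro allI impI ballI, rule ccontr)
    fix C r
    assume "config_size (sharp_digraph k) C = 3 * k + 1" "r \<in> verts (sharp_digraph k)"
      "\<not> solvable (sharp_digraph k) r C"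
    with config_size_unsolvable_le[OF strong_diameter_2_sharp_digraph[OF assms], of r C] V(1)
    show False by simp
  next
    fix t
    assume "\<forall>C. config_size (sharp_digraph k) C = t \<longrightarrow>
      (\<forall>r\<in>verts (sharp_digraph k). solvable (sharp_digraph k) r C)"
    then show "3 * k + 1 \<le> t"
      using unsolvable_config_sharp_digraph[of t k] V(2) by (metis not_less_eq_eq Suc_eq_plus1)
  qed
qed

theorem theorem3:
  shows "(\<forall>(D :: ('a, 'b) pre_digraph) n :: nat.
            digraph D \<and> verts D \<noteq> {} \<and> card (verts D) = n \<and> strong_diameter_2 D \<longrightarrow>
            real (pebbling_number D) < 3 / 2 * real n)
       \<and> (\<forall>k n :: nat. k \<ge> 1 \<and> n = 2 * k + 1 \<longrightarrow>
            (\<exists>D :: (nat, nat \<times> nat) pre_digraph.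
               digraph D \<and> card (verts D) = n \<and> strong_diameter_2 D \<and>
               pebbling_number D = 3 * k + 1)
            \<and> real (3 * k + 1) < 3 / 2 * real n
            \<and> (\<forall>m :: int. real_of_int m < 3 / 2 * real n \<longrightarrow> m \<le> int (3 * k + 1)))"
proof (intro conjI allI impI; elim conjE)
  fix D :: "('a, 'b) pre_digraph" and n :: nat
  assume D: "digraph D" "verts D \<noteq> {}" "card (verts D) = n" "strong_diameter_2 D"
  interpret digraph D by fact
  \<comment> \<open>For \<open>n = 0\<close> the strict inequality would fail.\<close>
  have "n > 0" using D(2,3) by auto
  then have "2 * pebbling_number D < 3 * n"
    using pebbling_number_le[OF D(4)] D(3) by linarith
  then show "real (pebbling_number D) < 3 / 2 * real n" by linarith
next
  fix k n :: nat
  assume "k \<ge> 1" "n = 2 * k + 1"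
  then show "\<exists>D :: (nat, nat \<times> nat) pre_digraph. digraph D \<and> card (verts D) = n \<and>
      strong_diameter_2 D \<and> pebbling_number D = 3 * k + 1"
    using digraph_sharp_digraph strong_diameter_2_sharp_digraph pebbling_number_sharp_digraph
    by (intro exI[of _ "sharp_digraph k"]) (simp add: sharp_digraph_def)
next
  fix k n :: nat
  assume "n = 2 * k + 1"
  then show "real (3 * k + 1) < 3 / 2 * real n" by simp
next
  fix k n :: nat and m :: int
  assume "n = 2 * k + 1" "real_of_int m < 3 / 2 * real n"
  then show "m \<le> int (3 * k + 1)" by linarith
qed

end
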